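(* Let $S$ be a finite set, let $\alpha>0$, let $\mu$ be a probability mass function on $S$ (a row vector) and let $r:S\to\mathbb{R}$ (a column vector). Let $(P_k(\epsilon):k\ge 1,\epsilon>0)$ be a family of stochastic matrices on $S$, and put $$\kappa(\epsilon)=\sum_{j=0}^{\infty}e^{-\alpha j}\,\mu\left(\prod_{k=1}^{j}P_k(\epsilon)\right)r .$$ Suppose there exist real scalars $(a_{i1}:i\ge 1)$, $S\times S$ real matrices $\tilde P,\tilde P^{(1)}$ (none of these depending on $\epsilon$), and scalars $s\in\mathbb{R}$, $\delta>0$, $p>0$ such that (i) $\sup_{1\le i\le(\log(1/\epsilon))^{1+\delta}}\|P_i(\epsilon)-(\tilde P+\epsilon a_{i1}\tilde P^{(1)})\|=O(\epsilon^2(\log(1/\epsilon))^s)$ as $\epsilon\downarrow0$; (ii) $|a_{i1}|=O(i^p)$ as $i\to\infty$. Then there exists $w<\infty$ such that $$\kappa(\epsilon)=\mu(I-e^{-\alpha}\tilde P)^{-1}r+\epsilon e^{-\alpha}\mu\sum_{k=0}^{\infty}a_{k+1,1}e^{-\alpha k}\tilde P^k\tilde P^{(1)}(I-e^{-\alpha}\tilde P)^{-1}r+O(\epsilon^2(\log(1/\epsilon))^w)$$ as $\epsilon\downarrow0$.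
   Context: Matrix products are taken in increasing order of index, $\prod_{i=k}^m A_i=A_kA_{k+1}\cdots A_m$, and an empty product is the identity. Norms: $\|A\|=\max_x\sum_y|A(x,y)|$ for square matrices, $\|\eta\|=\sum_x|\eta(x)|$ for row vectors, $\|f\|=\max_x|f(x)|$ for column vectors. $\kappa(\epsilon)$ is the expected infinite horizon discounted reward, with discount rate $\alpha$, of the non-stationary Markov chain with initial distribution $\mu$ and $k$-th step transition matrix $P_k(\epsilon)$. *)

theory Defs
  imports "HOL-Analysis.Analysis" "HOL-Library.Landau_Symbols"
begin

definition prob_vector :: "real ^ 's::finite \<Rightarrow> bool" where
  "prob_vector \<mu> \<longleftrightarrow> (\<forall>x. 0 \<le> \<mu> $ x) \<and> (\<Sum>x\<in>UNIV. \<mu> $ x) = 1"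

definition stochastic :: "real ^ 's ^ 's::finite \<Rightarrow> bool" where
  "stochastic A \<longleftrightarrow> (\<forall>x. prob_vector (A $ x))"

definition row_norm :: "real ^ 's ^ 's::finite \<Rightarrow> real" where
  "row_norm A = (MAX x. \<Sum>y\<in>UNIV. \<bar>A $ x $ y\<bar>)"

(* A k ** A (k + 1) ** ... ** A m, which is mat 1 if m < k *)
definition mat_prod :: "nat \<Rightarrow> nat \<Rightarrow> (nat \<Rightarrow> real ^ 's ^ 's) \<Rightarrow> real ^ 's ^ 's::finite" where
  "mat_prod k m A = foldr (\<lambda>i B. A i ** B) [k..<Suc m] (mat 1)"

(* The operators * and ^ act entrywise on the type vec, so the matrix power is defined here. *)
primrec mat_pow :: "real ^ 's ^ 's::finite \<Rightarrow> nat \<Rightarrow> real ^ 's ^ 's" where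
  "mat_pow A 0 = mat 1"
| "mat_pow A (Suc k) = A ** mat_pow A k"

(* Q k is the transition matrix of step k; only Q 1, Q 2, ... are used.
   Row vector times column vector is rendered as the inner product. *)
definition disc_reward ::
  "real \<Rightarrow> real ^ 's \<Rightarrow> real ^ 's \<Rightarrow> (nat \<Rightarrow> real ^ 's ^ 's) \<Rightarrow> real" where
  "disc_reward \<alpha> \<mu> r Q = (\<Sum>j. exp (- \<alpha> * real j) * ((\<mu> v* mat_prod 1 j Q) \<bullet> r))"

lemma prob_vector_mult_stochastic:
  assumes "prob_vector v" "stochastic A"
  shows "prob_vector (v v* A)"
proof -
  have nn: "0 \<le> v $ x" "0 \<le> A $ x $ y" and r: "(\<Sum>y\<in>UNIV. A $ x $ y) = 1" for x y
    using assms by (auto simp: prob_vector_def stochastic_def)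
  have "(\<Sum>y\<in>UNIV. \<Sum>x\<in>UNIV. A $ x $ y * v $ x) = (\<Sum>x\<in>UNIV. \<Sum>y\<in>UNIV. A $ x $ y * v $ x)"
    by (rule sum.swap)
  also have "\<dots> = (\<Sum>x\<in>UNIV. v $ x)"
    by (simp add: sum_distrib_right[symmetric] r)
  also have "\<dots> = 1" using assms by (simp add: prob_vector_def)
  finally show ?thesis
    using nn by (simp add: prob_vector_def vector_matrix_mult_def sum_nonneg mult.commute)
qed

lemma prob_vector_mult_foldr:
  assumes "prob_vector v" "\<And>i. i \<in> set l \<Longrightarrow> stochastic (Q i)"
  shows "prob_vector (v v* foldr (\<lambda>i B. Q i ** B) l (mat 1))"
  using assms
proof (induction l arbitrary: v)
  case Nil
  then show ?case by simp
next
  case (Cons i l)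
  then have "prob_vector ((v v* Q i) v* foldr (\<lambda>i B. Q i ** B) l (mat 1))"
    by (simp add: prob_vector_mult_stochastic)
  then show ?case by (simp add: vector_matrix_mul_assoc)
qed

lemma disc_reward_summable:
  assumes "\<alpha> > 0" "prob_vector \<mu>" "\<And>k. k \<ge> 1 \<Longrightarrow> stochastic (Q k)"
  shows "summable (\<lambda>j. exp (- \<alpha> * real j) * ((\<mu> v* mat_prod 1 j Q) \<bullet> r))"
proof (rule summable_comparison_test)
  have b: "\<bar>(\<mu> v* mat_prod 1 j Q) \<bullet> r\<bar> \<le> (\<Sum>x\<in>UNIV. \<bar>r $ x\<bar>)" for j
  proof -
    let ?v = "\<mu> v* mat_prod 1 j Q"
    have pv: "prob_vector ?v"
      unfolding mat_prod_def by (rule prob_vector_mult_foldr) (use assms in auto)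
    have le1: "?v $ x \<le> 1" for x
    proof -
      have "?v $ x \<le> (\<Sum>x\<in>UNIV. ?v $ x)"
        by (rule member_le_sum) (use pv in \<open>auto simp: prob_vector_def\<close>)
      then show ?thesis using pv by (simp add: prob_vector_def)
    qed
    have "\<bar>?v \<bullet> r\<bar> \<le> (\<Sum>x\<in>UNIV. \<bar>?v $ x * r $ x\<bar>)"
      unfolding inner_vec_def inner_real_def by (rule sum_abs)
    also have "\<dots> \<le> (\<Sum>x\<in>UNIV. \<bar>r $ x\<bar>)"
    proof (rule sum_mono)
      fix x
      have "0 \<le> ?v $ x" using pv by (simp add: prob_vector_def)
      then show "\<bar>?v $ x * r $ x\<bar> \<le> \<bar>r $ x\<bar>"
        using le1[of x] by (simp add: abs_mult mult_left_le_one_le)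
    qed
    finally show ?thesis .
  qed
  show "\<exists>N. \<forall>n\<ge>N. norm (exp (- \<alpha> * real n) * ((\<mu> v* mat_prod 1 n Q) \<bullet> r))
      \<le> exp (- \<alpha>) ^ n * (\<Sum>x\<in>UNIV. \<bar>r $ x\<bar>)"
    using b by (intro exI[of _ 0] allI impI)
      (simp add: abs_mult exp_of_nat_mult[symmetric] mult.commute mult_right_mono mult_left_mono)
  show "summable (\<lambda>n. exp (- \<alpha>) ^ n * (\<Sum>x\<in>UNIV. \<bar>r $ x\<bar>))"
    by (intro summable_mult2 summable_geometric) (use assms in simp)
qed

end

theory Submission
  imports Defs "HOL-Real_Asymp.Real_Asymp"
begin

text \<open>
  Write \<open>L = ln (1 / \<epsilon>)\<close> and \<open>Z = L powr (1 + \<delta>)\<close>. The matrix \<open>Pt\<close> is stochastic, being the limit of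
  \<open>P 1 \<epsilon>\<close>. Let \<open>m j\<close> be the coefficient of \<open>\<epsilon>\<close> in the formal expansion of
  \<open>\<mu> (Pt + \<epsilon> a\<^sub>1 Pt1) \<dots> (Pt + \<epsilon> a\<^sub>j Pt1)\<close>. The remainder
  \<open>e j = \<mu> P\<^sub>1 \<dots> P\<^sub>j - \<mu> Pt ^ j - \<epsilon> m j\<close> satisfies, with
  \<open>E j = P\<^sub>j - Pt - \<epsilon> a\<^sub>j Pt1\<close>, the one-step recursion
  \<open>e (j + 1) = e j P (j + 1) + \<mu> Pt ^ j E (j + 1) + \<epsilon> m j (P (j + 1) - Pt)\<close>. Stochastic matrices contract
  the \<open>l1\<close> norm, so for \<open>j \<le> Z\<close> the remainder is \<open>\<epsilon>\<^sup>2\<close> times a power of \<open>L\<close>; for \<open>j > Z\<close> it grows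
  polynomially in \<open>j\<close> at most, and there the discount factor is superpolynomially small in \<open>\<epsilon>\<close>.

  The generating functions \<open>V\<close> of \<open>\<mu> Pt ^ j\<close> and \<open>M\<close> of \<open>m j\<close> at \<open>x = exp (- \<alpha>)\<close> are evaluated by
  solving \<open>V = \<mu> + x V Pt\<close> and \<open>M = x \<mu> (\<Sum>k. a (k + 1) x ^ k Pt ^ k) Pt1 + x M Pt\<close>, which avoids Cauchy
  products of matrix series.
\<close>

section \<open>The l1 norm of row vectors and the row-sum norm of matrices\<close>

text \<open>Right multiplication by a stochastic matrix contracts this norm; the Euclidean
  \<open>norm\<close> of the type does not have that property.\<close>

definition l1 :: "real ^ 'n \<Rightarrow> real" where
  "l1 v = (\<Sum>x\<in>UNIV. \<bar>v $ x\<bar>)"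

lemma l1_nonneg [simp]: "0 \<le> l1 v"
  by (simp add: l1_def sum_nonneg)

lemma l1_0 [simp]: "l1 0 = 0"
  by (simp add: l1_def)

lemma l1_eq_0_iff: "l1 v = 0 \<longleftrightarrow> v = 0"
  by (simp add: l1_def sum_nonneg_eq_0_iff vec_eq_iff)

lemma l1_triangle: "l1 (v + w) \<le> l1 v + l1 w"
  by (simp add: l1_def sum_mono flip: sum.distrib)

lemma l1_scaleR: "l1 (c *\<^sub>R v) = \<bar>c\<bar> * l1 v"
  by (simp add: l1_def abs_mult sum_distrib_left)

lemma l1_minus: "l1 (- v) = l1 v"
  by (simp add: l1_def)

lemma l1_diff_triangle: "l1 (v - w) \<le> l1 v + l1 w"
  using l1_triangle[of v "- w"] by (simp add: l1_minus)

lemma norm_le_l1: "norm v \<le> l1 v"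
  by (simp add: l1_def norm_le_l1_cart)

lemma l1_prob_vector: "prob_vector v \<Longrightarrow> l1 v = 1"
  by (simp add: l1_def prob_vector_def)

text \<open>The maximum norm of \<open>r\<close> would be sharper, but \<open>l1 r\<close> only
  enters the constant of the final error bound.\<close>

lemma abs_inner_le_l1: "\<bar>v \<bullet> r\<bar> \<le> l1 v * l1 r"
proof -
  have "\<bar>v \<bullet> r\<bar> \<le> norm v * norm r"
    by (rule Cauchy_Schwarz_ineq2)
  also have "\<dots> \<le> l1 v * l1 r"
    by (intro mult_mono norm_le_l1) auto
  finally show ?thesis .
qed

lemma sum_abs_row_le_row_norm: "(\<Sum>y\<in>UNIV. \<bar>A $ x $ y\<bar>) \<le> row_norm A"
  unfolding row_norm_def by (rule Max_ge) auto

lemma row_norm_nonneg: "0 \<le> row_norm A"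
  by (rule order_trans[OF _ sum_abs_row_le_row_norm]) (simp add: sum_nonneg)

lemma abs_entry_le_row_norm: "\<bar>A $ x $ y\<bar> \<le> row_norm A"
  by (rule order_trans[OF member_le_sum sum_abs_row_le_row_norm]) auto

lemma row_norm_stochastic: "stochastic A \<Longrightarrow> row_norm A = 1"
  by (simp add: stochastic_def prob_vector_def row_norm_def)

text \<open>After interchanging the two sums, each \<open>\<bar>v $ x\<bar>\<close> is weighted by
  an absolute row sum of \<open>A\<close>.\<close>

lemma l1_vector_matrix_mult: "l1 (v v* A) \<le> row_norm A * l1 v"
proof -
  have "l1 (v v* A) \<le> (\<Sum>y\<in>UNIV. \<Sum>x\<in>UNIV. \<bar>v $ x\<bar> * \<bar>A $ x $ y\<bar>)"
    unfolding l1_def vector_matrix_mult_def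
    by (intro sum_mono) (simp add: order_trans[OF sum_abs] abs_mult sum_mono mult.commute)
  also have "\<dots> = (\<Sum>x\<in>UNIV. \<bar>v $ x\<bar> * (\<Sum>y\<in>UNIV. \<bar>A $ x $ y\<bar>))"
    by (subst sum.swap) (simp add: sum_distrib_left)
  also have "\<dots> \<le> (\<Sum>x\<in>UNIV. \<bar>v $ x\<bar> * row_norm A)"
    by (intro sum_mono mult_left_mono sum_abs_row_le_row_norm) auto
  finally show ?thesis
    by (simp add: l1_def mult.commute sum_distrib_left)
qed

lemma l1_mult_stochastic: "stochastic A \<Longrightarrow> l1 (v v* A) \<le> l1 v"
  using l1_vector_matrix_mult[of v A] by (simp add: row_norm_stochastic)

section \<open>Products, powers and resolvents of stochastic matrices\<close>

text \<open>The definition peels off the first factor, whereas the recursion for the remainder has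
  to peel off the last.\<close>

lemma mat_prod_Suc: "mat_prod 1 (Suc j) Q = mat_prod 1 j Q ** Q (Suc j)"
proof -
  \<comment> \<open>The seed \<open>mat 1\<close> is generalised to \<open>X\<close> so that the
    last factor can be pulled out of the fold.\<close>
  have "foldr (\<lambda>i B. Q i ** B) l X = foldr (\<lambda>i B. Q i ** B) l (mat 1) ** X" for l X
    by (induction l) (simp_all add: matrix_mul_assoc)
  from this[of "[1..<Suc j]" "Q (Suc j)"] show ?thesis
    by (simp add: mat_prod_def)
qed

lemma mat_pow_Suc_right: "mat_pow A (Suc k) = mat_pow A k ** A"
  by (induction k) (simp_all add: matrix_mul_assoc)

lemma prob_vector_mat_pow:
  "prob_vector v \<Longrightarrow> stochastic A \<Longrightarrow> prob_vector (v v* mat_pow A k)"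
  by (induction k arbitrary: v)
    (simp_all add: prob_vector_mult_stochastic flip: vector_matrix_mul_assoc)

lemma prob_vector_mat_prod:
  assumes "prob_vector v" "\<And>k. k \<ge> 1 \<Longrightarrow> stochastic (Q k)"
  shows "prob_vector (v v* mat_prod 1 j Q)"
  unfolding mat_prod_def using assms by (intro prob_vector_mult_foldr) auto

text \<open>The row is the law after \<open>k\<close> steps of the chain started at the unit mass
  \<open>axis x 1\<close>.\<close>

lemma row_mult_mat_pow: "stochastic A \<Longrightarrow> prob_vector (mat_pow A k $ x)"
  using prob_vector_mat_pow[of "axis x 1" A k]
  by (simp add: prob_vector_def axis_def if_distrib[of "\<lambda>z. z * _"] vector_matrix_mult_def cong: if_cong)

lemma norm_mat_pow_le:
  fixes A :: "real ^ 's ^ 's::finite"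
  assumes "stochastic A"
  shows "norm (mat_pow A k) \<le> real CARD('s)"
proof -
  have "norm (mat_pow A k) \<le> (\<Sum>x\<in>UNIV. norm (mat_pow A k $ x))"
    unfolding norm_vec_def by (rule L2_set_le_sum) auto
  also have "\<dots> \<le> (\<Sum>x\<in>(UNIV :: 's set). 1)"
  proof (rule sum_mono)
    fix x
    show "norm (mat_pow A k $ x) \<le> 1"
      using norm_le_l1[of "mat_pow A k $ x"] l1_prob_vector[OF row_mult_mat_pow[OF assms]] by simp
  qed
  finally show ?thesis by simp
qed

text \<open>A row vector in the kernel satisfies \<open>v = x *\<^sub>R (v v* A)\<close>.
  Contraction gives \<open>l1 v \<le> x * l1 v\<close>, so \<open>v = 0\<close> because
  \<open>x < 1\<close>.\<close>

lemma invertible_resolvent: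
  assumes "stochastic A" "0 \<le> x" "x < 1"
  shows "invertible (mat 1 - x *\<^sub>R A)"
proof -
  have "v = 0" if "v v* (mat 1 - x *\<^sub>R A) = 0" for v
  proof -
    have "v = x *\<^sub>R (v v* A)"
      using that by (simp add: vector_matrix_mult_diff_rdistrib vector_scaleR_matrix_ac)
    then have "l1 v = x * l1 (v v* A)"
      using l1_scaleR[of x "v v* A"] assms by simp
    also have "\<dots> \<le> x * l1 v"
      using assms by (intro mult_left_mono l1_mult_stochastic)
    finally have "(1 - x) * l1 v \<le> 0"
      by (simp add: algebra_simps)
    then show ?thesis
      using assms l1_nonneg[of v] by (simp add: mult_le_0_iff flip: l1_eq_0_iff)
  qed
  \<comment> \<open>The kernel criterion is about column vectors, so it is applied to the
    transpose.\<close>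
  then have "\<exists>B. B ** transpose (mat 1 - x *\<^sub>R A) = mat 1"
    by (subst matrix_left_invertible_ker) simp
  then show ?thesis
    by (simp add: left_invertible_transpose invertible_right_inverse)
qed

section \<open>Polynomial growth bounds\<close>

lemma powr_le_exp:
  fixes c q :: real
  assumes "c > 0"
  shows "\<exists>K\<ge>0. \<forall>j. real j powr q \<le> K * exp (c * real j)"
proof -
  have "(\<lambda>j. real j powr q / exp (c * real j)) \<longlonglongrightarrow> 0"
    using assms by real_asymp
  then have "Bseq (\<lambda>j. real j powr q / exp (c * real j))"
    by (intro convergent_imp_Bseq) (auto simp: convergent_def)
  then obtain K where "K > 0" "\<And>j. real j powr q / exp (c * real j) \<le> K"
    by (auto elim!: BseqE)
  then show ?thesis
    by (intro exI[of _ K]) (auto simp: field_simps)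
qed

text \<open>The \<open>O\<close> bound holds only eventually. The finitely many earlier values are
  absorbed into \<open>K\<close>, since \<open>real i powr p \<ge> 1\<close> for
  \<open>i \<ge> 1\<close>; index 0 is left out because \<open>0 powr p = 0\<close>.\<close>

lemma powr_growth_bound:
  fixes a :: "nat \<Rightarrow> real"
  assumes "(\<lambda>i. \<bar>a i\<bar>) \<in> O[at_top](\<lambda>i. real i powr p)" "p > 0"
  shows "\<exists>K\<ge>0. \<forall>i\<ge>1. \<bar>a i\<bar> \<le> K * real i powr p"
proof -
  from assms(1) obtain c where c: "c > 0" "eventually (\<lambda>i. norm \<bar>a i\<bar> \<le> c * norm (real i powr p)) at_top"
    by (rule landau_o.bigE)
  then obtain n where n: "\<And>i. i \<ge> n \<Longrightarrow> \<bar>a i\<bar> \<le> c * real i powr p"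
    by (auto simp: eventually_at_top_linorder)
  define K where "K = c + (\<Sum>i<n. \<bar>a i\<bar>)"
  have K: "K \<ge> c" "K \<ge> 0"
    using c by (auto simp: K_def sum_nonneg add_nonneg_nonneg)
  have "\<bar>a i\<bar> \<le> K * real i powr p" if "i \<ge> 1" for i
  proof (cases "i \<ge> n")
    case True
    then show ?thesis
      using n[of i] K mult_right_mono[of c K "real i powr p"] by simp
  next
    case False
    then have "\<bar>a i\<bar> \<le> (\<Sum>i<n. \<bar>a i\<bar>)"
      by (intro member_le_sum) auto
    also have "\<dots> \<le> K * 1"
      using c by (simp add: K_def)
    also have "\<dots> \<le> K * real i powr p"
      using that assms(2) K by (intro mult_left_mono ge_one_powr_ge_zero) auto
    finally show ?thesis .
  qed
  with K show ?thesis by blast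
qed


section \<open>First-order coefficients and the one-step recursion of the remainder\<close>

text \<open>In closed form this is the sum over \<open>1 \<le> i \<le> j\<close> of
  \<open>a i\<close> times \<open>v\<close> times \<open>A^(i-1) B A^(j-i)\<close>. The recursion
  distinguishes whether \<open>B\<close> occurs before the last factor or as the last
  factor.\<close>

primrec first_order ::
  "real ^ 's \<Rightarrow> real ^ 's ^ 's \<Rightarrow> real ^ 's ^ 's \<Rightarrow> (nat \<Rightarrow> real) \<Rightarrow> nat \<Rightarrow> real ^ 's::finite" where
  "first_order v A B a 0 = 0"
| "first_order v A B a (Suc j) =
     first_order v A B a j v* A + a (Suc j) *\<^sub>R (v v* mat_pow A j v* B)"

definition remainder ::
  "real ^ 's \<Rightarrow> real ^ 's ^ 's \<Rightarrow> real ^ 's ^ 's \<Rightarrow> (nat \<Rightarrow> real) \<Rightarrow> real \<Rightarrow>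
     (nat \<Rightarrow> real ^ 's ^ 's) \<Rightarrow> nat \<Rightarrow> real ^ 's::finite" where
  "remainder v A B a \<epsilon> Q j =
     v v* mat_prod 1 j Q - v v* mat_pow A j - \<epsilon> *\<^sub>R first_order v A B a j"

text \<open>\<open>A\<close> contracts and \<open>v v* mat_pow A j\<close> has mass 1, so each step
  adds at most \<open>\<bar>a (Suc j)\<bar> * row_norm B\<close>; the sum of the
  \<open>i powr p\<close> up to \<open>j\<close> is at most \<open>j powr (p + 1)\<close>.\<close>

lemma l1_first_order_le:
  assumes "stochastic A" "prob_vector v" "p > 0" "K \<ge> 0"
    and a: "\<And>i. i \<ge> 1 \<Longrightarrow> \<bar>a i\<bar> \<le> K * real i powr p"
  shows "l1 (first_order v A B a j) \<le> K * row_norm B * real j powr (p + 1)"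
proof (induction j)
  case 0
  then show ?case by simp
next
  case (Suc j)
  let ?b = "row_norm B"
  have "l1 (a (Suc j) *\<^sub>R (v v* mat_pow A j v* B)) \<le> (K * real (Suc j) powr p) * ?b"
    unfolding l1_scaleR
    using a[of "Suc j"] l1_vector_matrix_mult[of "v v* mat_pow A j" B]
      l1_prob_vector[OF prob_vector_mat_pow[OF assms(2,1)], of j] \<open>K \<ge> 0\<close>
    by (intro mult_mono) auto
  moreover have "l1 (first_order v A B a j v* A) \<le> K * ?b * real j powr (p + 1)"
    using l1_mult_stochastic[OF assms(1)] Suc.IH by (rule order_trans)
  ultimately have "l1 (first_order v A B a (Suc j))
      \<le> K * ?b * (real j powr (p + 1) + real (Suc j) powr p)"
    unfolding first_order.simps
    by (intro order_trans[OF l1_triangle]) (simp add: algebra_simps)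
  \<comment> \<open>Raising one factor \<open>j powr p\<close> to \<open>Suc j powr p\<close> makes
    the two summands combine to \<open>Suc j\<close> times \<open>Suc j powr p\<close>.\<close>
  also have "real j powr (p + 1) \<le> real j * real (Suc j) powr p"
    using \<open>p > 0\<close> by (cases "j = 0") (auto simp: powr_add mult.commute intro!: mult_left_mono powr_mono2)
  also have "real j * real (Suc j) powr p + real (Suc j) powr p = real (Suc j) powr (p + 1)"
    by (simp add: powr_add algebra_simps)
  finally show ?case
    using \<open>K \<ge> 0\<close> row_norm_nonneg[of B] by (simp add: mult_left_mono)
qed

text \<open>The factor \<open>Q (Suc j) - A\<close> that multiplies the first-order term is split
  into the small approximation error and the explicit multiple of \<open>B\<close>, so that each
  piece can be bounded separately.\<close>

lemma remainder_Suc: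
  fixes v :: "real ^ 's::finite"
  shows "remainder v A B a \<epsilon> Q (Suc j) = remainder v A B a \<epsilon> Q j v* Q (Suc j)
     + (v v* mat_pow A j) v* (Q (Suc j) - (A + (\<epsilon> * a (Suc j)) *\<^sub>R B))
     + \<epsilon> *\<^sub>R (first_order v A B a j v* (Q (Suc j) - (A + (\<epsilon> * a (Suc j)) *\<^sub>R B))
         + (\<epsilon> * a (Suc j)) *\<^sub>R (first_order v A B a j v* B))"
proof -
  have "u v* X - w v* A - \<epsilon> *\<^sub>R (m v* A + c *\<^sub>R (w v* B))
    = (u - w - \<epsilon> *\<^sub>R m) v* X + w v* (X - (A + (\<epsilon> * c) *\<^sub>R B))
      + \<epsilon> *\<^sub>R (m v* (X - (A + (\<epsilon> * c) *\<^sub>R B)) + (\<epsilon> * c) *\<^sub>R (m v* B))"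
    for u w m :: "real ^ 's" and X and c
    by (simp add: vector_scaleR_matrix_ac scaleR_vector_matrix_assoc algebra_simps)
  then show ?thesis
    unfolding remainder_def mat_prod_Suc mat_pow_Suc_right first_order.simps
      vector_matrix_mul_assoc[symmetric] .
qed

text \<open>The remainder starts at 0, its old value is contracted by \<open>Q (Suc j)\<close>, and
  the other terms of the recursion have a bound independent of \<open>j\<close>. Errors therefore
  accumulate only linearly.\<close>

lemma l1_remainder_le:
  assumes "stochastic A" "prob_vector v" "\<epsilon> \<ge> 0"
    and Q: "\<And>i. i \<ge> 1 \<Longrightarrow> stochastic (Q i)"
    and \<eta>: "\<And>i. 1 \<le> i \<Longrightarrow> i \<le> n \<Longrightarrow> row_norm (Q i - (A + (\<epsilon> * a i) *\<^sub>R B)) \<le> \<eta>"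
    and a: "\<And>i. 1 \<le> i \<Longrightarrow> i \<le> n \<Longrightarrow> \<bar>a i\<bar> \<le> a0" "0 \<le> a0"
    and M: "\<And>i. i \<le> n \<Longrightarrow> l1 (first_order v A B a i) \<le> M"
    and "j \<le> n"
  shows "l1 (remainder v A B a \<epsilon> Q j) \<le> real j * (\<eta> + \<epsilon> * (\<eta> * M + \<epsilon> * a0 * (row_norm B * M)))"
  using \<open>j \<le> n\<close>
proof (induction j)
  case 0
  then show ?case by (simp add: remainder_def mat_prod_def)
next
  case (Suc j)
  let ?E = "Q (Suc j) - (A + (\<epsilon> * a (Suc j)) *\<^sub>R B)"
  let ?m = "first_order v A B a j"
  have E: "row_norm ?E \<le> \<eta>" and m: "l1 ?m \<le> M" and a': "\<bar>a (Suc j)\<bar> \<le> a0"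
    using \<eta> M a Suc.prems by auto
  have \<eta>0: "0 \<le> \<eta>" using E row_norm_nonneg[of ?E] by linarith
  have 1: "l1 (remainder v A B a \<epsilon> Q j v* Q (Suc j)) \<le> l1 (remainder v A B a \<epsilon> Q j)"
    by (intro l1_mult_stochastic Q) simp
  have 2: "l1 ((v v* mat_pow A j) v* ?E) \<le> \<eta>"
    using l1_vector_matrix_mult[of "v v* mat_pow A j" ?E] E
      l1_prob_vector[OF prob_vector_mat_pow[OF assms(2,1)], of j] by simp
  have "l1 (?m v* ?E) \<le> \<eta> * M"
    by (rule order_trans[OF l1_vector_matrix_mult]) (use E m \<eta>0 in \<open>intro mult_mono; simp\<close>)
  moreover have "l1 ((\<epsilon> * a (Suc j)) *\<^sub>R (?m v* B)) \<le> \<epsilon> * a0 * (row_norm B * M)"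
  proof -
    have "l1 (?m v* B) \<le> row_norm B * M"
      using l1_vector_matrix_mult[of ?m B] mult_left_mono[OF m row_norm_nonneg[of B]] by linarith
    then show ?thesis
      unfolding l1_scaleR abs_mult using a' a(2) \<open>\<epsilon> \<ge> 0\<close> by (intro mult_mono) auto
  qed
  ultimately have "l1 (?m v* ?E + (\<epsilon> * a (Suc j)) *\<^sub>R (?m v* B))
      \<le> \<eta> * M + \<epsilon> * a0 * (row_norm B * M)"
    using l1_triangle[of "?m v* ?E" "(\<epsilon> * a (Suc j)) *\<^sub>R (?m v* B)"] by linarith
  then have 3: "l1 (\<epsilon> *\<^sub>R (?m v* ?E + (\<epsilon> * a (Suc j)) *\<^sub>R (?m v* B)))
      \<le> \<epsilon> * (\<eta> * M + \<epsilon> * a0 * (row_norm B * M))"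
    using \<open>\<epsilon> \<ge> 0\<close> by (simp add: l1_scaleR mult_left_mono)
  have "l1 (remainder v A B a \<epsilon> Q (Suc j)) \<le> l1 (remainder v A B a \<epsilon> Q j)
      + \<eta> + \<epsilon> * (\<eta> * M + \<epsilon> * a0 * (row_norm B * M))"
    unfolding remainder_Suc
    by (intro order_trans[OF l1_triangle] add_mono 1 2 3)
  with Suc show ?case by (simp add: algebra_simps)
qed

text \<open>This serves indices where no approximation of \<open>Q\<close> is available; the 2 is
  the total mass of the two probability vectors.\<close>

lemma l1_remainder_le_crude:
  assumes "stochastic A" "prob_vector v" "0 \<le> \<epsilon>" "\<epsilon> \<le> 1" "\<And>i. i \<ge> 1 \<Longrightarrow> stochastic (Q i)"
  shows "l1 (remainder v A B a \<epsilon> Q j) \<le> 2 + l1 (first_order v A B a j)"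
proof -
  have "l1 (remainder v A B a \<epsilon> Q j)
      \<le> l1 (v v* mat_prod 1 j Q) + l1 (v v* mat_pow A j) + l1 (\<epsilon> *\<^sub>R first_order v A B a j)"
    unfolding remainder_def using l1_diff_triangle by (rule order_trans) (simp add: l1_diff_triangle)
  also have "l1 (\<epsilon> *\<^sub>R first_order v A B a j) \<le> l1 (first_order v A B a j)"
    using assms by (simp add: l1_scaleR mult_left_le_one_le)
  finally show ?thesis
    using l1_prob_vector[OF prob_vector_mat_pow[OF assms(2,1), of j]]
      l1_prob_vector[OF prob_vector_mat_prod[where Q = Q and j = j, OF assms(2,5)]] by simp
qed

section \<open>Generating functions in closed form\<close>

lemma matrix_inv_right:
  "invertible A \<Longrightarrow> A ** matrix_inv A = mat 1"
  unfolding invertible_def matrix_inv_def by (rule someI2_ex) auto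

text \<open>Bounded linearity of the matrix products allows convergent series to be moved through
  them.\<close>

lemma bounded_linear_vector_matrix_mult_left:
  "bounded_linear (\<lambda>v. v v* (A :: real ^ 'n ^ 'm))"
  by (intro linear_conv_bounded_linear[THEN iffD1] linearI)
    (simp_all add: vector_matrix_left_distrib scaleR_vector_matrix_assoc)

lemma bounded_linear_vector_matrix_mult_right:
  "bounded_linear (\<lambda>A :: real ^ 'n ^ 'm. v v* A)"
  by (intro linear_conv_bounded_linear[THEN iffD1] linearI)
    (simp_all add: vector_matrix_mult_add_rdistrib vector_scaleR_matrix_ac)

lemma bounded_linear_matrix_mult_left:
  "bounded_linear (\<lambda>X :: real ^ 'n ^ 'm. X ** (A :: real ^ 'k ^ 'n))"
  by (intro linear_conv_bounded_linear[THEN iffD1] linearI)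
    (simp_all add: matrix_matrix_mult_def vec_eq_iff sum.distrib algebra_simps sum_distrib_left)

lemma eq_mult_resolvent:
  fixes A :: "real ^ 'n ^ 'n"
  assumes "invertible (mat 1 - x *\<^sub>R A)" "V = b + x *\<^sub>R (V v* A)"
  shows "V = b v* matrix_inv (mat 1 - x *\<^sub>R A)"
proof -
  have "V v* (mat 1 - x *\<^sub>R A) = b"
    using assms(2) by (simp add: vector_matrix_mult_diff_rdistrib vector_scaleR_matrix_ac diff_eq_eq)
  then have "b v* matrix_inv (mat 1 - x *\<^sub>R A) = V v* ((mat 1 - x *\<^sub>R A) ** matrix_inv (mat 1 - x *\<^sub>R A))"
    by (simp flip: vector_matrix_mul_assoc)
  then show ?thesis
    using assms(1) by (simp add: matrix_inv_right)
qed

lemma summable_powr_geometric: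
  fixes x q :: real
  assumes "0 < x" "x < 1"
  shows "summable (\<lambda>j. x ^ j * real j powr q)"
proof -
  \<comment> \<open>With \<open>x = exp (- 2 * c)\<close>, one factor \<open>exp (- c * j)\<close>
    absorbs the power of \<open>j\<close> and the other remains as a summable geometric
    majorant.\<close>
  define c where "c = - ln x / 2"
  have c: "c > 0" "exp (- c) < 1" and x: "x = exp (- 2 * c)"
    using assms by (auto simp: c_def)
  obtain K where K: "K \<ge> 0" "\<And>j. real j powr q \<le> K * exp (c * real j)"
    using powr_le_exp[OF c(1)] by blast
  show ?thesis
  proof (rule summable_comparison_test)
    show "\<exists>N. \<forall>j\<ge>N. norm (x ^ j * real j powr q) \<le> K * exp (- c) ^ j"
    proof (intro exI allI impI)
      fix j
      have "norm (x ^ j * real j powr q) \<le> x ^ j * (K * exp (c * real j))"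
        using assms K(2)[of j] by (simp add: abs_mult mult_left_mono)
      also have "\<dots> = K * exp (- c) ^ j"
        by (simp add: x exp_of_nat_mult[symmetric] exp_add[symmetric] algebra_simps)
      finally show "norm (x ^ j * real j powr q) \<le> K * exp (- c) ^ j" .
    qed
    show "summable (\<lambda>j. K * exp (- c) ^ j)"
      using c by (intro summable_mult summable_geometric) simp
  qed
qed

lemma summable_scaleR_l1:
  fixes f :: "nat \<Rightarrow> real ^ 'n"
  assumes "\<And>j. l1 (f j) \<le> C * real j powr q" "0 < x" "x < 1"
  shows "summable (\<lambda>j. x ^ j *\<^sub>R f j)"
proof (rule summable_comparison_test)
  show "\<exists>N. \<forall>j\<ge>N. norm (x ^ j *\<^sub>R f j) \<le> C * (x ^ j * real j powr q)"
  proof (intro exI allI impI)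
    fix j
    have "norm (f j) \<le> C * real j powr q"
      using norm_le_l1 assms(1) by (rule order_trans)
    then show "norm (x ^ j *\<^sub>R f j) \<le> C * (x ^ j * real j powr q)"
      using mult_left_mono[of "norm (f j)" "C * real j powr q" "x ^ j"] assms(2) by (simp add: mult_ac)
  qed
  show "summable (\<lambda>j. C * (x ^ j * real j powr q))"
    using assms by (intro summable_mult summable_powr_geometric)
qed

text \<open>Splitting off the term \<open>j = 0\<close>, which is \<open>v\<close>, and pulling
  \<open>x\<close> and \<open>A\<close> out of the rest gives a fixed-point equation solved by the
  resolvent.\<close>

lemma zeroth_order_sums:
  assumes "stochastic A" "prob_vector v" "0 < x" "x < 1"
  shows "(\<lambda>j. x ^ j *\<^sub>R (v v* mat_pow A j)) sums (v v* matrix_inv (mat 1 - x *\<^sub>R A))"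
proof -
  let ?f = "\<lambda>j. x ^ j *\<^sub>R (v v* mat_pow A j)"
  have sf: "summable ?f"
  proof (rule summable_comparison_test)
    show "\<exists>N. \<forall>j\<ge>N. norm (?f j) \<le> x ^ j"
    proof (intro exI allI impI)
      fix j
      have "norm (v v* mat_pow A j) \<le> 1"
        using norm_le_l1 l1_prob_vector[OF prob_vector_mat_pow[OF assms(2,1)]] by metis
      then show "norm (?f j) \<le> x ^ j"
        using assms(3) by (simp add: mult_left_le)
    qed
    show "summable (\<lambda>j. x ^ j)"
      using assms by (intro summable_geometric) simp
  qed
  have "(\<Sum>j. ?f (Suc j)) = (\<Sum>j. x *\<^sub>R (?f j v* A))"
    by (simp add: mat_pow_Suc_right scaleR_vector_matrix_assoc flip: vector_matrix_mul_assoc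
        del: mat_pow.simps(2))
  also have "\<dots> = x *\<^sub>R (suminf ?f v* A)"
    by (intro sums_unique[symmetric] sums_scaleR_right summable_sums[OF sf]
        bounded_linear.sums[OF bounded_linear_vector_matrix_mult_left])
  finally have "suminf ?f = v + x *\<^sub>R (suminf ?f v* A)"
    using suminf_split_head[OF sf] by simp
  then have "suminf ?f = v v* matrix_inv (mat 1 - x *\<^sub>R A)"
    using assms by (intro eq_mult_resolvent invertible_resolvent) auto
  then show ?thesis
    using sf summable_sums by metis
qed

lemma first_order_sums:
  fixes A B :: "real ^ 's ^ 's::finite"
  assumes "stochastic A" "prob_vector v" "0 < x" "x < 1" "p > 0" "K \<ge> 0"
    and a: "\<And>i. i \<ge> 1 \<Longrightarrow> \<bar>a i\<bar> \<le> K * real i powr p"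
  defines "T \<equiv> \<lambda>k. (a (k + 1) * x ^ k) *\<^sub>R (mat_pow A k ** B ** matrix_inv (mat 1 - x *\<^sub>R A))"
  shows "summable T" "(\<lambda>j. x ^ j *\<^sub>R first_order v A B a j) sums (x *\<^sub>R (v v* suminf T))"
proof -
  let ?R = "matrix_inv (mat 1 - x *\<^sub>R A)"
  let ?U = "\<lambda>k. (a (k + 1) * x ^ k) *\<^sub>R mat_pow A k"
  let ?f = "\<lambda>j. x ^ j *\<^sub>R first_order v A B a j"
  have sU: "summable ?U"
  proof (rule summable_comparison_test)
    \<comment> \<open>The majorant is taken at \<open>Suc j\<close> to match
      \<open>a (j + 1)\<close>; the division by \<open>x\<close> compensates for the shifted power
      of \<open>x\<close>.\<close>
    let ?C = "real CARD('s) * K / x"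
    show "\<exists>N. \<forall>j\<ge>N. norm (?U j) \<le> ?C * (x ^ Suc j * real (Suc j) powr p)"
    proof (intro exI allI impI)
      fix j
      have "norm (?U j) \<le> (K * real (Suc j) powr p * x ^ j) * real CARD('s)"
        unfolding norm_scaleR real_norm_def abs_mult using assms(3) a[of "Suc j"] \<open>K \<ge> 0\<close>
        by (intro mult_mono norm_mat_pow_le assms) auto
      also have "\<dots> = ?C * (x ^ Suc j * real (Suc j) powr p)"
        using assms(3) by simp
      finally show "norm (?U j) \<le> ?C * (x ^ Suc j * real (Suc j) powr p)" .
    qed
    show "summable (\<lambda>j. ?C * (x ^ Suc j * real (Suc j) powr p))"
      using summable_powr_geometric[OF assms(3,4), of p]
      by (intro summable_mult) (subst summable_Suc_iff)
  qed
  \<comment> \<open>The right factor \<open>B ** ?R\<close> does not depend on \<open>k\<close>, so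
    the series \<open>T\<close> reduces to the series \<open>?U\<close>.\<close>
  have T: "T = (\<lambda>k. ?U k ** (B ** ?R))"
    by (simp add: T_def fun_eq_iff matrix_mul_assoc
        linear_cmul[OF bounded_linear.linear[OF bounded_linear_matrix_mult_left]])
  show "summable T"
    unfolding T by (rule bounded_linear.summable[OF bounded_linear_matrix_mult_left sU])
  have ST: "suminf T = suminf ?U ** (B ** ?R)"
    unfolding T by (rule bounded_linear.suminf[OF bounded_linear_matrix_mult_left sU, symmetric])
  have sf: "summable ?f"
    by (rule summable_scaleR_l1[OF l1_first_order_le[OF assms(1,2,5,6) a] assms(3,4)])
  have "bounded_linear (\<lambda>X. v v* X v* B)"
    using bounded_linear_compose[OF bounded_linear_vector_matrix_mult_left bounded_linear_vector_matrix_mult_right] .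
  note sv = bounded_linear.sums[OF this summable_sums[OF sU]]
  have "(\<lambda>j. ?f (Suc j)) = (\<lambda>j. x *\<^sub>R (?f j v* A + v v* ?U j v* B))"
    by (simp add: fun_eq_iff vector_scaleR_matrix_ac scaleR_vector_matrix_assoc algebra_simps)
  moreover have "\<dots> sums (x *\<^sub>R (suminf ?f v* A + v v* suminf ?U v* B))"
    by (intro sums_scaleR_right sums_add sv
        bounded_linear.sums[OF bounded_linear_vector_matrix_mult_left summable_sums[OF sf]])
  ultimately have "(\<Sum>j. ?f (Suc j)) = x *\<^sub>R (suminf ?f v* A + v v* suminf ?U v* B)"
    by (simp add: sums_iff)
  \<comment> \<open>The head term vanishes because \<open>first_order\<close> starts at 0.\<close>
  then have "suminf ?f = x *\<^sub>R (v v* suminf ?U v* B) + x *\<^sub>R (suminf ?f v* A)"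
    using suminf_split_head[OF sf] by (simp add: algebra_simps)
  then have "suminf ?f = (x *\<^sub>R (v v* suminf ?U v* B)) v* ?R"
    using assms by (intro eq_mult_resolvent invertible_resolvent) auto
  also have "\<dots> = x *\<^sub>R (v v* suminf T)"
    by (simp add: ST vector_matrix_mul_assoc scaleR_vector_matrix_assoc matrix_mul_assoc)
  finally show "?f sums (x *\<^sub>R (v v* suminf T))"
    using sf summable_sums by metis
qed

section \<open>Limits of stochastic matrices\<close>

lemma stochastic_limit:
  assumes "F \<noteq> bot" "\<forall>\<^sub>F t in F. stochastic (f t)" "\<And>x y. ((\<lambda>t. f t $ x $ y) \<longlongrightarrow> A $ x $ y) F"
  shows "stochastic A"
  unfolding stochastic_def prob_vector_def
proof (intro allI conjI)
  fix x y
  show "0 \<le> A $ x $ y"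
    using assms(2) by (intro tendsto_lowerbound[OF assms(3) _ assms(1)])
      (auto elim!: eventually_mono simp: stochastic_def prob_vector_def)
next
  fix x
  have "((\<lambda>t. \<Sum>y\<in>UNIV. f t $ x $ y) \<longlongrightarrow> (\<Sum>y\<in>UNIV. A $ x $ y)) F"
    by (intro tendsto_sum assms(3))
  moreover have "((\<lambda>t. \<Sum>y\<in>UNIV. f t $ x $ y) \<longlongrightarrow> 1) F"
    using assms(2) by (intro tendsto_eventually)
      (auto elim!: eventually_mono simp: stochastic_def prob_vector_def)
  ultimately show "(\<Sum>y\<in>UNIV. A $ x $ y) = 1"
    using assms(1) tendsto_unique by blast
qed

text \<open>Entries are dominated by the row norm and the perturbation \<open>\<epsilon> * c\<close>
  times \<open>B\<close> vanishes, so \<open>Q \<epsilon>\<close> tends to \<open>A\<close>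
  entrywise. This makes the limit matrix of the theorem stochastic.\<close>

lemma stochastic_first_order_limit:
  assumes "\<And>\<epsilon>. \<epsilon> > 0 \<Longrightarrow> stochastic (Q \<epsilon>)"
    and "\<forall>\<^sub>F \<epsilon> in at_right 0. row_norm (Q \<epsilon> - (A + (\<epsilon> * c) *\<^sub>R B)) \<le> g \<epsilon>"
    and "(g \<longlongrightarrow> 0) (at_right (0::real))"
  shows "stochastic A"
proof (rule stochastic_limit)
  show "\<forall>\<^sub>F \<epsilon> in at_right 0. stochastic (Q \<epsilon>)"
    using assms(1) eventually_at_right_less[of 0] by (auto elim: eventually_mono)
next
  fix x y
  have "((\<lambda>\<epsilon>. (Q \<epsilon> - (A + (\<epsilon> * c) *\<^sub>R B)) $ x $ y) \<longlongrightarrow> 0) (at_right 0)"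
  proof (rule Lim_null_comparison[OF _ assms(3)])
    show "\<forall>\<^sub>F \<epsilon> in at_right 0. norm ((Q \<epsilon> - (A + (\<epsilon> * c) *\<^sub>R B)) $ x $ y) \<le> g \<epsilon>"
      using assms(2)
      by (rule eventually_mono) (unfold real_norm_def, rule order_trans[OF abs_entry_le_row_norm])
  qed
  moreover have "((\<lambda>\<epsilon>. A $ x $ y + (\<epsilon> * c) * B $ x $ y) \<longlongrightarrow> A $ x $ y + (0 * c) * B $ x $ y) (at_right 0)"
    by (intro tendsto_intros)
  ultimately have "((\<lambda>\<epsilon>. (Q \<epsilon> - (A + (\<epsilon> * c) *\<^sub>R B)) $ x $ y + (A $ x $ y + (\<epsilon> * c) * B $ x $ y))
      \<longlongrightarrow> 0 + (A $ x $ y + (0 * c) * B $ x $ y)) (at_right 0)"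
    by (rule tendsto_add)
  then show "((\<lambda>\<epsilon>. Q \<epsilon> $ x $ y) \<longlongrightarrow> A $ x $ y) (at_right 0)"
    by simp
qed simp

section \<open>Size of the remainder and the exact error series\<close>

text \<open>The exponent \<open>2 * p + 2\<close> is \<open>1 + p + (p + 1)\<close>: at most
  \<open>Z\<close> steps, coefficients of order \<open>Z powr p\<close>, and first-order terms of
  order \<open>Z powr (p + 1)\<close>.\<close>

lemma l1_remainder_le_powr:
  assumes "stochastic A" "prob_vector v" "0 \<le> \<epsilon>" "\<epsilon> \<le> 1"
    and Q: "\<And>i. i \<ge> 1 \<Longrightarrow> stochastic (Q i)"
    and row: "\<And>i. 1 \<le> i \<Longrightarrow> real i \<le> Z \<Longrightarrow> row_norm (Q i - (A + (\<epsilon> * a i) *\<^sub>R B)) \<le> C * \<epsilon>\<^sup>2 * X"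
    and a: "\<And>i. i \<ge> 1 \<Longrightarrow> \<bar>a i\<bar> \<le> K * real i powr p"
    and "1 \<le> X" "1 \<le> Z" "0 \<le> C" "0 \<le> K" "0 < p" "real j \<le> Z"
  shows "l1 (remainder v A B a \<epsilon> Q j)
    \<le> (C + C * K * row_norm B + (K * row_norm B)\<^sup>2) * \<epsilon>\<^sup>2 * (Z powr (2 * p + 2) * X)"
proof -
  let ?b = "row_norm B" and ?W = "Z powr (2 * p + 2)"
  have b: "0 \<le> ?b" by (rule row_norm_nonneg)
  have le: "i \<le> nat \<lfloor>Z\<rfloor> \<longleftrightarrow> real i \<le> Z" for i
    using \<open>1 \<le> Z\<close> by (simp add: le_nat_iff le_floor_iff)
  have "l1 (remainder v A B a \<epsilon> Q j)
    \<le> real j * (C * \<epsilon>\<^sup>2 * X + \<epsilon> * (C * \<epsilon>\<^sup>2 * X * (K * ?b * Z powr (p + 1))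
        + \<epsilon> * (K * Z powr p) * (?b * (K * ?b * Z powr (p + 1)))))"
  proof (rule l1_remainder_le[where n = "nat \<lfloor>Z\<rfloor>"])
    fix i assume "1 \<le> i" "i \<le> nat \<lfloor>Z\<rfloor>"
    then show "\<bar>a i\<bar> \<le> K * Z powr p"
      using \<open>0 < p\<close> \<open>0 \<le> K\<close>
      by (intro order_trans[OF a[of i] mult_left_mono] powr_mono2) (auto simp: le)
  next
    fix i assume "i \<le> nat \<lfloor>Z\<rfloor>"
    then have "real i powr (p + 1) \<le> Z powr (p + 1)"
      using \<open>0 < p\<close> by (intro powr_mono2) (auto simp: le)
    then show "l1 (first_order v A B a i) \<le> K * ?b * Z powr (p + 1)"
      using b \<open>0 \<le> K\<close>
      by (intro order_trans[OF l1_first_order_le[OF assms(1,2) \<open>0 < p\<close> \<open>0 \<le> K\<close> a]] mult_left_mono) auto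
  qed (use assms in \<open>auto simp: le\<close>)
  also have "\<dots> \<le> Z * (C * \<epsilon>\<^sup>2 * X + \<epsilon> * (C * \<epsilon>\<^sup>2 * X * (K * ?b * Z powr (p + 1))
        + \<epsilon> * (K * Z powr p) * (?b * (K * ?b * Z powr (p + 1)))))"
    using assms b by (intro mult_right_mono) auto
  also have "\<dots> = C * \<epsilon>\<^sup>2 * X * Z + \<epsilon> * (C * K * ?b * \<epsilon>\<^sup>2 * X * (Z * Z powr (p + 1)))
        + (K * ?b)\<^sup>2 * \<epsilon>\<^sup>2 * (Z * Z powr p * Z powr (p + 1))"
    by (simp add: algebra_simps power2_eq_square)
  \<comment> \<open>As \<open>Z \<ge> 1\<close>, every power of \<open>Z\<close> is raised to
    \<open>?W\<close>. The surplus \<open>\<epsilon>\<close> of the second term is bounded by 1, and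
    the third term receives the factor \<open>X \<ge> 1\<close>.\<close>
  also have "\<dots> \<le> C * \<epsilon>\<^sup>2 * X * ?W + 1 * (C * K * ?b * \<epsilon>\<^sup>2 * X * ?W) + (K * ?b)\<^sup>2 * \<epsilon>\<^sup>2 * (X * ?W)"
  proof -
    have W1: "Z \<le> ?W"
      using assms powr_mono[of 1 "2 * p + 2" Z] by simp
    have "Z * Z powr (p + 1) = Z powr (1 + (p + 1))"
      using assms by (subst powr_add) auto
    also have "\<dots> \<le> ?W"
      using assms by (intro powr_mono) auto
    finally have W2: "Z * Z powr (p + 1) \<le> ?W" .
    have "Z * Z powr p * Z powr (p + 1) = Z powr (1 + p + (p + 1))"
      using assms by (simp only: powr_add) simp
    also have "1 + p + (p + 1) = 2 * p + 2" by simp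
    also have "?W \<le> X * ?W"
      using assms mult_right_mono[of 1 X ?W] by simp
    finally have W3: "Z * Z powr p * Z powr (p + 1) \<le> X * ?W" .
    have "0 \<le> C * K * ?b * \<epsilon>\<^sup>2 * X"
      using assms b by simp
    then have "\<epsilon> * (C * K * ?b * \<epsilon>\<^sup>2 * X * (Z * Z powr (p + 1))) \<le> 1 * (C * K * ?b * \<epsilon>\<^sup>2 * X * ?W)"
      using assms by (intro mult_mono[OF \<open>\<epsilon> \<le> 1\<close> mult_left_mono[OF W2]]) auto
    moreover have "C * \<epsilon>\<^sup>2 * X * Z \<le> C * \<epsilon>\<^sup>2 * X * ?W"
      using assms by (intro mult_left_mono W1) auto
    moreover have "(K * ?b)\<^sup>2 * \<epsilon>\<^sup>2 * (Z * Z powr p * Z powr (p + 1)) \<le> (K * ?b)\<^sup>2 * \<epsilon>\<^sup>2 * (X * ?W)"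
      by (intro mult_left_mono W3) auto
    ultimately show ?thesis by linarith
  qed
  also have "\<dots> = (C + C * K * ?b + (K * ?b)\<^sup>2) * \<epsilon>\<^sup>2 * (?W * X)"
    by (simp add: algebra_simps)
  finally show ?thesis .
qed

text \<open>The remainder is an exact difference, so subtracting the two closed generating functions
  from the reward series term by term leaves exactly the discounted remainders.\<close>

lemma disc_reward_minus_expansion:
  fixes A B :: "real ^ 's ^ 's::finite"
  assumes "\<alpha> > 0" "stochastic A" "prob_vector v" "\<And>k. k \<ge> 1 \<Longrightarrow> stochastic (Q k)" "p > 0" "K \<ge> 0"
    and a: "\<And>i. i \<ge> 1 \<Longrightarrow> \<bar>a i\<bar> \<le> K * real i powr p"
  defines "R \<equiv> matrix_inv (mat 1 - exp (- \<alpha>) *\<^sub>R A)"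
  defines "T \<equiv> \<lambda>k. (a (k + 1) * exp (- \<alpha> * real k)) *\<^sub>R (mat_pow A k ** B ** R)"
  shows "summable T"
    and "(\<lambda>j. exp (- \<alpha>) ^ j * (remainder v A B a \<epsilon> Q j \<bullet> r)) sums
      (disc_reward \<alpha> v r Q - ((v v* R) \<bullet> r + \<epsilon> * exp (- \<alpha>) * ((v v* suminf T) \<bullet> r)))"
proof -
  define x where "x = exp (- \<alpha>)"
  have x: "0 < x" "x < 1"
    using \<open>\<alpha> > 0\<close> by (auto simp: x_def)
  have pow: "exp (- (\<alpha> * real k)) = x ^ k" for k
    by (simp add: x_def mult.commute flip: exp_of_nat_mult)
  have T: "T = (\<lambda>k. (a (k + 1) * x ^ k) *\<^sub>R (mat_pow A k ** B ** matrix_inv (mat 1 - x *\<^sub>R A)))"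
    by (simp add: T_def R_def pow flip: x_def)
  note fo = first_order_sums[OF assms(2,3) x assms(5,6) a, where B = B, folded T]
  show "summable T"
    using fo(1) .
  have "(\<lambda>j. x ^ j * ((v v* mat_prod 1 j Q) \<bullet> r)) sums disc_reward \<alpha> v r Q"
    using summable_sums[OF disc_reward_summable[where Q = Q and r = r, OF assms(1,3,4)]]
    by (simp add: disc_reward_def pow)
  moreover have "(\<lambda>j. (x ^ j *\<^sub>R (v v* mat_pow A j)) \<bullet> r) sums ((v v* R) \<bullet> r)"
    unfolding R_def x_def[symmetric]
    by (intro bounded_linear.sums[OF bounded_linear_inner_left] zeroth_order_sums assms(2,3) x)
  moreover have "(\<lambda>j. \<epsilon> * ((x ^ j *\<^sub>R first_order v A B a j) \<bullet> r)) sums (\<epsilon> * ((x *\<^sub>R (v v* suminf T)) \<bullet> r))"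
    by (intro sums_mult bounded_linear.sums[OF bounded_linear_inner_left] fo(2))
  ultimately have "(\<lambda>j. x ^ j * ((v v* mat_prod 1 j Q) \<bullet> r)
        - ((x ^ j *\<^sub>R (v v* mat_pow A j)) \<bullet> r + \<epsilon> * ((x ^ j *\<^sub>R first_order v A B a j) \<bullet> r)))
      sums (disc_reward \<alpha> v r Q - ((v v* R) \<bullet> r + \<epsilon> * ((x *\<^sub>R (v v* suminf T)) \<bullet> r)))"
    by (intro sums_diff sums_add)
  then show "(\<lambda>j. exp (- \<alpha>) ^ j * (remainder v A B a \<epsilon> Q j \<bullet> r)) sums
      (disc_reward \<alpha> v r Q - ((v v* R) \<bullet> r + \<epsilon> * exp (- \<alpha>) * ((v v* suminf T) \<bullet> r)))"
    by (simp add: remainder_def inner_diff_left algebra_simps flip: x_def)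
qed

text \<open>The polynomial growth in the crude bound is traded for an arbitrarily small exponential
  rate, with \<open>D\<close> uniform in \<open>\<epsilon>\<close>, \<open>Q\<close> and
  \<open>j\<close>.\<close>

lemma l1_remainder_le_exp:
  fixes A B :: "real ^ 's ^ 's::finite"
  assumes "stochastic A" "prob_vector v" "p > 0" "K \<ge> 0" "c > 0"
    and "\<And>i. i \<ge> 1 \<Longrightarrow> \<bar>a i\<bar> \<le> K * real i powr p"
  shows "\<exists>D\<ge>0. \<forall>\<epsilon> Q j. 0 \<le> \<epsilon> \<longrightarrow> \<epsilon> \<le> 1 \<longrightarrow> (\<forall>i\<ge>1. stochastic (Q i)) \<longrightarrow>
    l1 (remainder v A B a \<epsilon> Q j) \<le> D * exp (c * real j)"
proof -
  obtain G where G: "G \<ge> 0" "\<And>j. real j powr (p + 1) \<le> G * exp (c * real j)"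
    using powr_le_exp[OF \<open>c > 0\<close>] by blast
  have b: "0 \<le> K * row_norm B"
    using \<open>K \<ge> 0\<close> by (simp add: row_norm_nonneg)
  show ?thesis
  proof (intro exI[of _ "2 + K * row_norm B * G"] conjI allI impI)
    show "0 \<le> 2 + K * row_norm B * G"
      using b G by simp
    fix \<epsilon> :: real and Q :: "nat \<Rightarrow> real ^ 's ^ 's" and j
    assume "0 \<le> \<epsilon>" "\<epsilon> \<le> 1" "\<forall>i\<ge>1. stochastic (Q i)"
    then have "l1 (remainder v A B a \<epsilon> Q j) \<le> 2 + l1 (first_order v A B a j)"
      using assms by (intro l1_remainder_le_crude) auto
    also have "l1 (first_order v A B a j) \<le> K * row_norm B * real j powr (p + 1)"
      by (intro l1_first_order_le assms)
    also have "\<dots> \<le> K * row_norm B * (G * exp (c * real j))"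
      by (intro mult_left_mono G b)
    also have "2 + \<dots> \<le> 2 * exp (c * real j) + K * row_norm B * (G * exp (c * real j))"
      using \<open>c > 0\<close> by simp
    finally show "l1 (remainder v A B a \<epsilon> Q j) \<le> (2 + K * row_norm B * G) * exp (c * real j)"
      by (simp add: algebra_simps)
  qed
qed

section \<open>The error rate, uniformly over short and long horizons\<close>

theorem theorem1:
  fixes \<alpha> s \<delta> p :: real
    and \<mu> r :: "real ^ 's::finite"
    and P :: "nat \<Rightarrow> real \<Rightarrow> real ^ 's ^ 's"
    and a :: "nat \<Rightarrow> real"
    and Pt Pt1 :: "real ^ 's ^ 's"
  assumes "\<alpha> > 0"
    and "prob_vector \<mu>"
    and "\<And>k \<epsilon>. k \<ge> 1 \<Longrightarrow> \<epsilon> > 0 \<Longrightarrow> stochastic (P k \<epsilon>)"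
    and "\<delta> > 0" and "p > 0"
    and "(\<lambda>\<epsilon>. SUP i\<in>{i. 1 \<le> i \<and> real i \<le> ln (1 / \<epsilon>) powr (1 + \<delta>)}.
            row_norm (P i \<epsilon> - (Pt + (\<epsilon> * a i) *\<^sub>R Pt1)))
         \<in> O[at_right 0](\<lambda>\<epsilon>. \<epsilon>\<^sup>2 * ln (1 / \<epsilon>) powr s)"
    and "(\<lambda>i. \<bar>a i\<bar>) \<in> O[at_top](\<lambda>i. real i powr p)"
  shows "let R = matrix_inv (mat 1 - exp (- \<alpha>) *\<^sub>R Pt);
             T = (\<lambda>k. (a (k + 1) * exp (- \<alpha> * real k)) *\<^sub>R (mat_pow Pt k ** Pt1 ** R))
         in invertible (mat 1 - exp (- \<alpha>) *\<^sub>R Pt) \<and> summable T \<and>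
            (\<exists>w. (\<lambda>\<epsilon>. disc_reward \<alpha> \<mu> r (\<lambda>k. P k \<epsilon>)
                     - ((\<mu> v* R) \<bullet> r + \<epsilon> * exp (- \<alpha>) * ((\<mu> v* (\<Sum>k. T k)) \<bullet> r)))
                 \<in> O[at_right 0](\<lambda>\<epsilon>. \<epsilon>\<^sup>2 * ln (1 / \<epsilon>) powr w))"
proof -
  define Z where "Z = (\<lambda>\<epsilon>. ln (1 / \<epsilon>) powr (1 + \<delta>))"
  \<comment> \<open>The absolute value ensures \<open>X \<epsilon> \<ge> 1\<close> and
    \<open>ln (1 / \<epsilon>) powr s \<le> X \<epsilon>\<close> once
    \<open>ln (1 / \<epsilon>) \<ge> 1\<close>.\<close>
  define X where "X = (\<lambda>\<epsilon>. ln (1 / \<epsilon>) powr \<bar>s\<bar>)"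
  \<comment> \<open>This is the exponent of \<open>ln (1 / \<epsilon>)\<close> in
    \<open>Z \<epsilon> powr (2 * p + 2) * X \<epsilon>\<close>.\<close>
  define w where "w = (1 + \<delta>) * (2 * p + 2) + \<bar>s\<bar>"
  \<comment> \<open>Beyond \<open>Z\<close> the rate \<open>\<alpha>\<close> is divided: one half
    cancels the growth of the remainder, one quarter produces \<open>\<epsilon>\<^sup>2\<close>, and
    the last quarter stays as the summable \<open>y ^ j\<close>.\<close>
  define y where "y = exp (- (\<alpha> / 4))"
  let ?x = "exp (- \<alpha>)"
  let ?E = "\<lambda>\<epsilon> i. row_norm (P i \<epsilon> - (Pt + (\<epsilon> * a i) *\<^sub>R Pt1))"
  have small: "\<forall>\<^sub>F \<epsilon>::real in at_right 0. 0 < \<epsilon> \<and> \<epsilon> \<le> 1 \<and> 1 \<le> ln (1 / \<epsilon>)"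
    unfolding eventually_conj_iff
  proof (intro conjI)
    show "\<forall>\<^sub>F \<epsilon>::real in at_right 0. 0 < \<epsilon>" by (rule eventually_at_right_less)
    show "\<forall>\<^sub>F \<epsilon>::real in at_right 0. \<epsilon> \<le> 1" by real_asymp
    show "\<forall>\<^sub>F \<epsilon>::real in at_right 0. 1 \<le> ln (1 / \<epsilon>)" by real_asymp
  qed
  \<comment> \<open>Since \<open>\<delta> > 0\<close>, \<open>Z\<close> outgrows
    \<open>ln (1 / \<epsilon>)\<close>, and
    \<open>\<epsilon>\<^sup>2 = exp (- 2 * ln (1 / \<epsilon>))\<close>.\<close>
  have tail: "\<forall>\<^sub>F \<epsilon> in at_right 0. exp (- (\<alpha> / 4) * Z \<epsilon>) \<le> \<epsilon>\<^sup>2"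
    unfolding Z_def using \<open>\<alpha> > 0\<close> \<open>\<delta> > 0\<close> by real_asymp
  obtain K where K: "K \<ge> 0" and aK: "\<And>i. i \<ge> 1 \<Longrightarrow> \<bar>a i\<bar> \<le> K * real i powr p"
    using powr_growth_bound[OF assms(7,5)] by blast
  obtain C where C: "C > 0"
    and SUP: "\<forall>\<^sub>F \<epsilon> in at_right 0. norm (SUP i\<in>{i. 1 \<le> i \<and> real i \<le> Z \<epsilon>}. ?E \<epsilon> i)
      \<le> C * norm (\<epsilon>\<^sup>2 * ln (1 / \<epsilon>) powr s)"
    using landau_o.bigE[OF assms(6)] unfolding Z_def by blast
  have row: "\<forall>\<^sub>F \<epsilon> in at_right 0. \<forall>i. 1 \<le> i \<longrightarrow> real i \<le> Z \<epsilon> \<longrightarrow> ?E \<epsilon> i \<le> C * \<epsilon>\<^sup>2 * X \<epsilon>"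
    using SUP small
  proof eventually_elim
    case (elim \<epsilon>)
    show ?case
    proof (intro allI impI)
      fix i :: nat assume i: "1 \<le> i" "real i \<le> Z \<epsilon>"
      \<comment> \<open>Finiteness of the index set makes the family bounded above, so that the
        supremum dominates each member.\<close>
      have "{i. 1 \<le> i \<and> real i \<le> Z \<epsilon>} \<subseteq> {..nat \<lceil>Z \<epsilon>\<rceil>}"
        by (auto simp: le_nat_iff) linarith
      then have "finite {i. 1 \<le> i \<and> real i \<le> Z \<epsilon>}"
        by (rule finite_subset) simp
      then have "?E \<epsilon> i \<le> (SUP i\<in>{i. 1 \<le> i \<and> real i \<le> Z \<epsilon>}. ?E \<epsilon> i)"
        using i by (intro cSUP_upper bdd_above_finite finite_imageI) auto
      also have "\<dots> \<le> C * (\<epsilon>\<^sup>2 * ln (1 / \<epsilon>) powr s)"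
        using elim by (simp add: abs_mult)
      also have "\<dots> \<le> C * (\<epsilon>\<^sup>2 * X \<epsilon>)"
        unfolding X_def using elim C by (intro mult_left_mono powr_mono) auto
      finally show "?E \<epsilon> i \<le> C * \<epsilon>\<^sup>2 * X \<epsilon>"
        by (simp add: mult_ac)
    qed
  qed
  have Pt: "stochastic Pt"
  proof (rule stochastic_first_order_limit)
    show "\<And>\<epsilon>. \<epsilon> > 0 \<Longrightarrow> stochastic (P 1 \<epsilon>)"
      using assms(3) by simp
    show "\<forall>\<^sub>F \<epsilon> in at_right 0. ?E \<epsilon> 1 \<le> C * \<epsilon>\<^sup>2 * X \<epsilon>"
      using row small
    proof eventually_elim
      case (elim \<epsilon>)
      \<comment> \<open>Index 1 then lies in the range where the approximation holds.\<close>
      have "1 \<le> Z \<epsilon>"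
        unfolding Z_def using elim \<open>\<delta> > 0\<close> by (intro ge_one_powr_ge_zero) auto
      with elim show ?case by simp
    qed
    show "((\<lambda>\<epsilon>. C * \<epsilon>\<^sup>2 * X \<epsilon>) \<longlongrightarrow> 0) (at_right 0)"
      unfolding X_def by real_asymp
  qed
  obtain D where D: "D \<ge> 0" and rem_exp: "\<And>\<epsilon> Q j. 0 \<le> \<epsilon> \<Longrightarrow> \<epsilon> \<le> 1 \<Longrightarrow> (\<And>i. i \<ge> 1 \<Longrightarrow> stochastic (Q i)) \<Longrightarrow>
      l1 (remainder \<mu> Pt Pt1 a \<epsilon> Q j) \<le> D * exp (\<alpha> / 2 * real j)"
    using l1_remainder_le_exp[OF Pt assms(2,5) K _ aK, of "\<alpha> / 2" Pt1] \<open>\<alpha> > 0\<close> by auto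
  define G where "G = C + C * K * row_norm Pt1 + (K * row_norm Pt1)\<^sup>2"
  have G: "0 \<le> G"
    using C K row_norm_nonneg[of Pt1] by (simp add: G_def)
  have x1: "norm ?x < 1" and y1: "norm y < 1" and y0: "0 < y"
    using \<open>\<alpha> > 0\<close> by (auto simp: y_def)
  let ?S = "(G * (1 / (1 - ?x)) + D * (1 / (1 - y))) * l1 r"
  have rate: "(\<lambda>\<epsilon>. disc_reward \<alpha> \<mu> r (\<lambda>k. P k \<epsilon>)
      - ((\<mu> v* matrix_inv (mat 1 - ?x *\<^sub>R Pt)) \<bullet> r + \<epsilon> * ?x * ((\<mu> v* (\<Sum>k. (a (k + 1) *
          exp (- \<alpha> * real k)) *\<^sub>R (mat_pow Pt k ** Pt1 ** matrix_inv (mat 1 - ?x *\<^sub>R Pt)))) \<bullet> r)))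
      \<in> O[at_right 0](\<lambda>\<epsilon>. \<epsilon>\<^sup>2 * ln (1 / \<epsilon>) powr w)" (is "?d \<in> _")
  proof (rule bigoI)
    show "\<forall>\<^sub>F \<epsilon> in at_right 0. norm (?d \<epsilon>) \<le> ?S * norm (\<epsilon>\<^sup>2 * ln (1 / \<epsilon>) powr w)"
      using small tail row
    proof eventually_elim
      case (elim \<epsilon>)
      let ?rem = "remainder \<mu> Pt Pt1 a \<epsilon> (\<lambda>k. P k \<epsilon>)"
      let ?Y = "ln (1 / \<epsilon>) powr w"
      have XZ: "1 \<le> X \<epsilon>" "1 \<le> Z \<epsilon>"
        unfolding X_def Z_def using elim \<open>\<delta> > 0\<close> by (auto intro!: ge_one_powr_ge_zero)
      have Y: "Z \<epsilon> powr (2 * p + 2) * X \<epsilon> = ?Y"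
        by (simp only: X_def Z_def w_def powr_powr flip: powr_add)
      have Y1: "1 \<le> ?Y"
        using elim \<open>\<delta> > 0\<close> \<open>p > 0\<close> by (intro ge_one_powr_ge_zero) (auto simp: w_def)
      have stoch: "\<And>k. k \<ge> 1 \<Longrightarrow> stochastic (P k \<epsilon>)"
        using assms(3) elim by simp
      \<comment> \<open>Adding the majorants of the two ranges gives one bound for all
        \<open>j\<close>, and the series need not be split at \<open>Z \<epsilon>\<close>.\<close>
      have bound: "norm (?x ^ j * (?rem j \<bullet> r)) \<le> (\<epsilon>\<^sup>2 * ?Y * l1 r) * (G * ?x ^ j + D * y ^ j)" for j
      proof -
        have "?x ^ j * l1 (?rem j) \<le> \<epsilon>\<^sup>2 * ?Y * (G * ?x ^ j + D * y ^ j)"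
        proof (cases "real j \<le> Z \<epsilon>")
          case True
          have "l1 (?rem j) \<le> G * \<epsilon>\<^sup>2 * ?Y"
            unfolding Y[symmetric] G_def
            by (rule l1_remainder_le_powr) (use assms(2,5) Pt elim stoch aK XZ C K True in auto)
          then have "?x ^ j * l1 (?rem j) \<le> \<epsilon>\<^sup>2 * ?Y * (G * ?x ^ j)"
            using mult_left_mono[of "l1 (?rem j)" _ "?x ^ j"] by (simp add: mult_ac)
          also have "\<dots> \<le> \<epsilon>\<^sup>2 * ?Y * (G * ?x ^ j + D * y ^ j)"
            using D y0 by (intro mult_left_mono) auto
          finally show ?thesis .
        next
          case False
          have "?x ^ j * l1 (?rem j) \<le> ?x ^ j * (D * exp (\<alpha> / 2 * real j))"
            using elim stoch by (intro mult_left_mono rem_exp) auto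
          also have "\<dots> = exp (- (\<alpha> / 4) * real j) * (D * y ^ j)"
            by (simp add: y_def exp_of_nat_mult[symmetric] exp_add[symmetric] field_simps)
          also have "\<dots> \<le> \<epsilon>\<^sup>2 * (D * y ^ j)"
          proof (rule mult_right_mono)
            have "exp (- (\<alpha> / 4) * real j) \<le> exp (- (\<alpha> / 4) * Z \<epsilon>)"
              using False \<open>\<alpha> > 0\<close> by simp
            with elim show "exp (- (\<alpha> / 4) * real j) \<le> \<epsilon>\<^sup>2" by linarith
          qed (use D y0 in auto)
          also have "\<dots> \<le> \<epsilon>\<^sup>2 * ?Y * (G * ?x ^ j + D * y ^ j)"
          proof (rule mult_mono)
            show "\<epsilon>\<^sup>2 \<le> \<epsilon>\<^sup>2 * ?Y"
              using mult_left_mono[OF Y1, of "\<epsilon>\<^sup>2"] by simp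
            show "D * y ^ j \<le> G * ?x ^ j + D * y ^ j" "0 \<le> D * y ^ j"
              using D G y0 by simp_all
          qed simp
          finally show ?thesis .
        qed
        then have "?x ^ j * l1 (?rem j) * l1 r \<le> \<epsilon>\<^sup>2 * ?Y * (G * ?x ^ j + D * y ^ j) * l1 r"
          by (rule mult_right_mono) simp
        moreover have "norm (?x ^ j * (?rem j \<bullet> r)) \<le> ?x ^ j * (l1 (?rem j) * l1 r)"
          by (simp add: abs_mult abs_inner_le_l1)
        ultimately show ?thesis
          by (simp add: mult_ac)
      qed
      have g: "(\<lambda>j. (\<epsilon>\<^sup>2 * ?Y * l1 r) * (G * ?x ^ j + D * y ^ j))
          sums ((\<epsilon>\<^sup>2 * ?Y * l1 r) * (G * (1 / (1 - ?x)) + D * (1 / (1 - y))))"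
        by (intro sums_mult sums_add geometric_sums x1 y1)
      have "norm (\<Sum>j. ?x ^ j * (?rem j \<bullet> r))
          \<le> (\<epsilon>\<^sup>2 * ?Y * l1 r) * (G * (1 / (1 - ?x)) + D * (1 / (1 - y)))"
        unfolding sums_unique[OF g] by (rule norm_suminf_le[OF bound sums_summable[OF g]])
      moreover have "(\<Sum>j. ?x ^ j * (?rem j \<bullet> r)) = ?d \<epsilon>"
        by (rule sums_unique[symmetric], rule disc_reward_minus_expansion(2)[where p = p and K = K])
          (use assms(1,2,5) Pt stoch K aK in auto)
      ultimately show ?case
        by (simp add: mult_ac)
    qed
  qed
  have inv: "invertible (mat 1 - ?x *\<^sub>R Pt)"
    using \<open>\<alpha> > 0\<close> by (intro invertible_resolvent Pt) auto
  have "summable (\<lambda>k. (a (k + 1) * exp (- \<alpha> * real k)) *\<^sub>R (mat_pow Pt k ** Pt1 ** matrix_inv (mat 1 - ?x *\<^sub>R Pt)))"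
    \<comment> \<open>\<open>T\<close> does not depend on the chain, so any stochastic sequence can
      be supplied; \<open>P k 1\<close> is one.\<close>
    by (rule disc_reward_minus_expansion(1)[where Q = "\<lambda>k. P k 1" and p = p and K = K]) (use assms Pt K aK in auto)
  with rate inv show ?thesis
    unfolding Let_def by blast
qed

end
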